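(* Let $m,i,j$ be positive integers and let $q=2^m$, $Q_1=2^i$, $Q_2=2^j$. The polynomial $$f_C(x)=x^{q(Q_1+Q_2+1)}+x^{qQ_1+Q_2+1}+x^{qQ_2+Q_1+1}+x^{q+Q_1+Q_2}+x^{Q_1+Q_2+1}\in\mathbb{F}_{q^2}[x]$$ is a permutation of $\mathbb{F}_{q^2}$ if and only if one of the following holds: (i) $m$ is odd, $(1+i)(1+j)\equiv 1\pmod 2$, and $\gcd(Q_1+Q_2+1,q-1)=1$; moreover, in this case $f_C$ is linear equivalent to the function $(u,v)\mapsto(u^{Q_1+Q_2+1},v^{Q_1+Q_2+1})$ from $\mathbb{F}_q^2$ to $\mathbb{F}_q^2$; (ii) $m$ is even and $\gcd(Q_1+Q_2+1,q-1)=\gcd(Q_1+Q_2+1-2r_C,q+1)=1$, where the integer $r_C$ is defined by: $r_C=0$ if $i\equiv j\equiv 0\pmod 2$; $r_C=1$ if $i\equiv j\equiv 1\pmod 2$; $r_C=Q_1$ if $i\equiv 1$, $j\equiv 0\pmod 2$ and $Q_1\le Q_2$; $r_C=Q_2+1$ if $i\equiv 1$, $j\equiv 0\pmod 2$ and $Q_1>Q_2$; $r_C=Q_1+1$ if $i\equiv 0$, $j\equiv 1\pmod 2$ and $Q_1<Q_2$; $r_C=Q_2$ if $i\equiv 0$, $j\equiv 1\pmod 2$ and $Q_1\ge Q_2$. Moreover, in this case $f_C$ is linear equivalent to the function $x\mapsto x^{Q_1+Q_2+1+r_C(q-1)}$ on $\mathbb{F}_{q^2}$.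
   Context: A map is called linear here if it is additive (i.e. $\mathbb{F}_2$-linear). A function $F$ on $\mathbb{F}_{q^2}$ is linear equivalent to a function $P:X\to X$ (where $X=\mathbb{F}_{q^2}$ or $X=\mathbb{F}_q^2$) if $F=L_1\circ P\circ L_2$ for some additive bijections $L_2:\mathbb{F}_{q^2}\to X$ and $L_1:X\to\mathbb{F}_{q^2}$. *)

theory Defs
  imports
    "HOL-Computational_Algebra.Polynomial"
    "HOL-Number_Theory.Cong"
    "HOL-Library.Product_Plus"
begin

text \<open>
  In a field with \<open>2 ^ (2 * m)\<close> elements this set is the unique subfield with \<open>2 ^ m\<close> elements.
\<close>

definition Fq :: "nat \<Rightarrow> 'a::{field,finite} set" where
  "Fq m = {x. x ^ (2 ^ m) = x}"

text \<open>
  The set \<open>X\<close> is meant to be an additive subgroup (all of the field, or \<open>Fq m \<times> Fq m\<close>).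
  Only the values of \<open>L1\<close> and \<open>P\<close> on \<open>X\<close> matter, so additivity of \<open>L1\<close> is relativised to \<open>X\<close>.
\<close>

definition linear_equivalent ::
    "('a::{field,finite} \<Rightarrow> 'a) \<Rightarrow> 'b::ab_group_add set \<Rightarrow> ('b \<Rightarrow> 'b) \<Rightarrow> bool" where
  "linear_equivalent F X P \<longleftrightarrow>
     P ` X \<subseteq> X \<and>
     (\<exists>L1 L2.
        bij_betw L2 UNIV X \<and> (\<forall>x y. L2 (x + y) = L2 x + L2 y) \<and>
        bij_betw L1 X UNIV \<and> (\<forall>u\<in>X. \<forall>v\<in>X. L1 (u + v) = L1 u + L1 v) \<and>
        (\<forall>x. F x = L1 (P (L2 x))))"

definition f_C :: "nat \<Rightarrow> nat \<Rightarrow> nat \<Rightarrow> 'a::{field,finite} poly" where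
  "f_C m i j =
     (let q = 2 ^ m; Q1 = 2 ^ i; Q2 = 2 ^ j in
        monom 1 (q * (Q1 + Q2 + 1)) + monom 1 (q * Q1 + Q2 + 1) + monom 1 (q * Q2 + Q1 + 1)
        + monom 1 (q + Q1 + Q2) + monom 1 (Q1 + Q2 + 1))"

definition r_C :: "nat \<Rightarrow> nat \<Rightarrow> nat" where
  "r_C i j =
     (let Q1 = 2 ^ i; Q2 = 2 ^ j in
        if even i \<and> even j then 0
        else if odd i \<and> odd j then 1
        else if odd i \<and> even j then (if Q1 \<le> Q2 then Q1 else Q2 + 1)
        else (if Q1 < Q2 then Q1 + 1 else Q2))"

end

theory Submission
  imports Defs
begin

text \<open>
  Write \<open>y = x ^ q\<close> and let \<open>\<omega>\<close> be a primitive cube root of unity. As a polynomial in the Frobenius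
  images of \<open>x\<close> and \<open>y\<close>, \<open>f_C\<close> is a symmetric trilinear form whose coefficient sequence \<open>1, 1, 0, 1\<close>
  satisfies the recurrence with characteristic roots \<open>\<omega>\<close> and \<open>\<omega> + 1\<close>. It is therefore a sum of two
  products of linear forms, in \<open>U = x + \<omega> y\<close> and \<open>V = x + (\<omega> + 1) y\<close>; raising to the power \<open>2 ^ k\<close>
  fixes or swaps these two forms according to the parity of \<open>k\<close>.

  Put \<open>d = 2 ^ i + 2 ^ j + 1\<close>. If \<open>m\<close> is odd, \<open>U\<close> and \<open>V\<close> are independent \<open>F_q\<close>-coordinates, up to
  scalars; \<open>f_C\<close> either splits into \<open>U ^ d\<close> and \<open>V ^ d\<close> or vanishes on the line \<open>U = 0\<close>. If \<open>m\<close> is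
  even, \<open>V\<close> is a scalar multiple of \<open>U ^ q\<close>, and \<open>f_C\<close> is a linear bijection applied to a monomial
  in \<open>U\<close>.
\<close>

section \<open>Power maps on finite fields\<close>

text \<open>Multiplication by \<open>x\<close> permutes the nonzero elements, so it does not change
  their product, which is itself nonzero and can be cancelled.\<close>

lemma power_card_minus_one:
  fixes x :: "'a::{field,finite}"
  assumes "x \<noteq> 0"
  shows "x ^ (card (UNIV :: 'a set) - 1) = 1"
proof -
  let ?S = "UNIV - {0 :: 'a}"
  have "bij_betw (\<lambda>y. x * y) ?S ?S"
    by (rule bij_betw_byWitness[where f' = "\<lambda>y. y / x"]) (use assms in auto)
  then have "(\<Prod>y\<in>?S. x * y) = \<Prod>?S"
    by (rule prod.reindex_bij_betw)
  moreover have "(\<Prod>y\<in>?S. x * y) = x ^ card ?S * \<Prod>?S"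
    by (simp add: prod.distrib)
  moreover have "\<Prod>?S \<noteq> 0"
    by simp
  ultimately show ?thesis
    by (simp add: card_Diff_singleton)
qed

text \<open>Translation by 1 permutes the field. Comparing the sums of all elements gives
  \<open>2 ^ n = 0\<close>, so the prime characteristic divides a power of two.\<close>

lemma CHAR_eq_2_if_card_eq_power:
  assumes "card (UNIV :: 'a::{field,finite} set) = 2 ^ n"
  shows "CHAR('a) = 2"
proof -
  have "bij (\<lambda>x::'a. x + 1)"
    by (rule bij_betw_byWitness[where f' = "\<lambda>x. x - 1"]) auto
  then have "(\<Sum>x\<in>UNIV. x + 1) = (\<Sum>x\<in>UNIV. x :: 'a)"
    by (rule sum.reindex_bij_betw)
  then have "of_nat (2 ^ n) = (0 :: 'a)"
    by (simp add: sum.distrib flip: assms)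
  then have "CHAR('a) dvd 2 ^ n"
    by (simp only: of_nat_eq_0_iff_char_dvd)
  moreover have "prime CHAR('a)"
    by (simp add: finite_imp_CHAR_pos prime_CHAR_semidom)
  ultimately show ?thesis
    by (metis prime_dvd_power primes_dvd_imp_eq two_is_prime_nat)
qed

text \<open>Write the order of the unit group as \<open>p * k\<close>. The polynomial
  \<open>X ^ k - 1\<close> has at most \<open>k < p * k\<close> roots, so some unit has a nontrivial
  \<open>k\<close>-th power, and that power is the witness.\<close>

lemma exists_root_of_unity:
  assumes "prime p" and "p dvd card (UNIV :: 'a::{field,finite} set) - 1"
  obtains y :: "'a::{field,finite}" where "y \<noteq> 1" "y ^ p = 1"
proof -
  let ?N = "card (UNIV :: 'a set) - 1"
  obtain k where k: "?N = p * k"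
    using assms(2) by blast
  have "card {0, 1 :: 'a} \<le> card (UNIV :: 'a set)"
    by (rule card_mono) auto
  then have N: "?N > 0"
    by simp
  with k have k0: "k > 0"
    by (cases k) auto
  have "\<exists>x::'a. x \<noteq> 0 \<and> x ^ k \<noteq> 1"
  proof (rule ccontr)
    assume "\<not> ?thesis"
    then have sub: "UNIV - {0 :: 'a} \<subseteq> {x. x ^ k = 1}"
      by blast
    let ?p = "monom 1 k - 1 :: 'a poly"
    have deg: "degree ?p \<le> k"
      by (rule degree_diff_le) (auto simp: degree_monom_le)
    have "coeff ?p k = 1"
      using k0 by simp
    then have "?p \<noteq> 0"
      by (metis coeff_0 zero_neq_one)
    have "{x::'a. x ^ k = 1} = {x. poly ?p x = 0}"
      by (simp add: poly_monom)
    then have "card {x::'a. x ^ k = 1} \<le> k"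
      using card_poly_roots_bound[OF \<open>?p \<noteq> 0\<close>] deg by simp
    moreover have "card (UNIV - {0 :: 'a}) \<le> card {x::'a. x ^ k = 1}"
      using sub by (intro card_mono) auto
    moreover have "card (UNIV - {0 :: 'a}) = p * k"
      using k by (simp add: card_Diff_singleton)
    ultimately have "p * k \<le> k"
      by linarith
    with k0 prime_gt_1_nat[OF assms(1)] show False
      by simp
  qed
  then obtain x :: 'a where x: "x \<noteq> 0" "x ^ k \<noteq> 1"
    by blast
  have "(x ^ k) ^ p = 1"
    using power_card_minus_one[OF x(1)] k by (simp add: mult.commute flip: power_mult)
  with x(2) show ?thesis
    by (rule that)
qed

text \<open>The domain is 0 together with the \<open>n\<close>-th roots of unity;
  \<open>n = q - 1\<close> gives the subfield and \<open>n = q ^ 2 - 1\<close> the whole field. A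
  common prime factor yields a root of unity that collides with 1; conversely, Bezout shows that the
  quotient of two colliding units is 1.\<close>

lemma inj_on_power_iff_coprime:
  assumes n: "n dvd card (UNIV :: 'a::{field,finite} set) - 1" and e: "e > 0"
  shows "inj_on (\<lambda>x. x ^ e) {x :: 'a. x ^ Suc n = x} \<longleftrightarrow> coprime e n"
proof
  assume inj: "inj_on (\<lambda>x. x ^ e) {x :: 'a. x ^ Suc n = x}"
  show "coprime e n"
  proof (rule ccontr)
    assume "\<not> coprime e n"
    then have "gcd e n \<noteq> 1"
      by (simp add: coprime_iff_gcd_eq_1)
    then obtain p where p: "prime p" "p dvd e" "p dvd n"
      by (metis gcd_greatest_iff prime_factor_nat)
    obtain y :: 'a where y: "y \<noteq> 1" "y ^ p = 1"
      using exists_root_of_unity[OF p(1)] p(3) n dvd_trans by blast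
    have "y ^ e = 1" "y ^ n = 1"
      using p y(2) by (auto simp: power_mult)
    then have "y = 1"
      using inj_onD[OF inj, of y 1] by simp
    with y(1) show False ..
  qed
next
  assume cop: "coprime e n"
  show "inj_on (\<lambda>x. x ^ e) {x :: 'a. x ^ Suc n = x}"
  proof (rule inj_onI, goal_cases)
    case (1 x y)
    show "x = y"
    proof (cases "y = 0")
      case True
      with 1 e show ?thesis
        by (simp add: power_0_left)
    next
      case False
      then have "x \<noteq> 0"
        using 1 e by (auto simp: power_0_left)
      have xy: "x ^ n = 1" "y ^ n = 1"
        using 1 False \<open>x \<noteq> 0\<close> by auto
      define z where "z = x / y"
      have z: "z ^ e = 1" "z ^ n = 1"
        using 1 False xy by (simp_all add: z_def power_divide)
      obtain a b where "e * a = n * b + 1"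
        using bezout_nat[of e n] e cop by (auto simp: coprime_iff_gcd_eq_1)
      then have "(z ^ e) ^ a = (z ^ n) ^ b * z"
        by (simp flip: power_mult add: power_add)
      with z have "z = 1"
        by simp
      with False show ?thesis
        by (simp add: z_def)
    qed
  qed
qed

text \<open>The outer maps are bijections, and a self-map of a finite set is bijective once it is
  injective.\<close>

lemma linear_equivalent_bij_iff:
  assumes "linear_equivalent F X P"
  shows "bij F \<longleftrightarrow> inj_on P X"
proof -
  obtain L1 L2 where PX: "P ` X \<subseteq> X" and L2: "bij_betw L2 UNIV X"
    and L1: "bij_betw L1 X UNIV" and F: "\<And>x. F x = L1 (P (L2 x))"
    using assms unfolding linear_equivalent_def by blast
  have X: "L2 ` UNIV = X"
    using L2 by (simp add: bij_betw_def)
  have "bij F \<longleftrightarrow> inj F"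
    by (metis bij_def finite finite_UNIV_inj_surj)
  also have "\<dots> \<longleftrightarrow> inj (L1 \<circ> (P \<circ> L2))"
    by (simp add: comp_def F[abs_def])
  also have "\<dots> \<longleftrightarrow> inj (P \<circ> L2)"
  proof -
    have "inj_on L1 ((P \<circ> L2) ` UNIV)"
      using L1 PX X unfolding bij_betw_def by (metis image_comp inj_on_subset)
    then show ?thesis
      by (metis comp_inj_on inj_on_imageI2)
  qed
  also have "\<dots> \<longleftrightarrow> inj_on P X"
    using L2 X by (metis bij_betw_def comp_inj_on inj_on_imageI inj_on_imageI2 comp_inj_on_iff)
  finally show ?thesis .
qed

lemma power_power_commute: "(x ^ n) ^ k = (x ^ k) ^ n" for x :: "'a::monoid_mult"
  by (simp only: mult.commute flip: power_mult)

lemma Fq_power: "x \<in> Fq m \<Longrightarrow> x ^ n \<in> Fq m"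
  unfolding Fq_def mem_Collect_eq by (subst power_power_commute) simp

lemma inj_on_map_prod_same:
  "inj_on (\<lambda>(u, v). (g u, g v)) (A \<times> A) \<longleftrightarrow> inj_on g A"
  by (auto simp: inj_on_def)

text \<open>The exponent is congruent to \<open>d\<close> modulo \<open>q - 1\<close> and, since
  \<open>q - 1\<close> is congruent to -2, to \<open>d - 2 * r\<close> modulo \<open>q + 1\<close>.
  The latter may be negative, hence the integers.\<close>

lemma coprime_exponent_iff:
  assumes q: "q \<ge> 1"
  shows "coprime (d + r * (q - 1)) (q ^ 2 - 1) \<longleftrightarrow>
    coprime d (q - 1) \<and> coprime (int d - 2 * int r) (int q + 1)"
proof -
  have "q ^ 2 - 1 = (q - 1) * (q + 1)"
    using q by (simp add: algebra_simps power2_eq_square)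
  then have "coprime (d + r * (q - 1)) (q ^ 2 - 1) \<longleftrightarrow>
      coprime (d + r * (q - 1)) (q - 1) \<and> coprime (d + r * (q - 1)) (q + 1)"
    by (simp only: coprime_mult_right_iff)
  moreover have "coprime (d + r * (q - 1)) (q - 1) \<longleftrightarrow> coprime d (q - 1)"
    by (metis coprime_commute coprime_iff_gcd_eq_1 gcd_add_mult add.commute)
  moreover have "coprime (d + r * (q - 1)) (q + 1) \<longleftrightarrow>
      coprime (int d - 2 * int r) (int q + 1)"
  proof -
    have "coprime (d + r * (q - 1)) (q + 1) \<longleftrightarrow> coprime (int (d + r * (q - 1))) (int (q + 1))"
      by (rule coprime_int_iff[symmetric])
    also have "int (d + r * (q - 1)) = int r * (int q + 1) + (int d - 2 * int r)"
      using q by (cases q) (simp_all add: algebra_simps)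
    also have "coprime \<dots> (int (q + 1)) \<longleftrightarrow> coprime (int d - 2 * int r) (int q + 1)"
      by (metis coprime_commute coprime_iff_gcd_eq_1 gcd_add_mult of_nat_Suc Suc_eq_plus1 add.commute)
    finally show ?thesis .
  qed
  ultimately show ?thesis
    by blast
qed

section \<open>Quadratic extensions in characteristic two\<close>

locale char2_quadratic_extension =
  fixes m :: nat and \<omega> :: "'a::{field,finite}"
  assumes card_UNIV: "card (UNIV :: 'a set) = (2 ^ m) ^ 2"
    and omega_sq: "\<omega> ^ 2 = \<omega> + 1"
begin

lemma CHAR_eq_2: "CHAR('a) = 2"
  using CHAR_eq_2_if_card_eq_power[where 'a = 'a, of "m * 2"] by (simp add: card_UNIV power_mult)

lemma two_eq_0: "(2 :: 'a) = 0"
  using of_nat_CHAR[where 'a = 'a] by (simp add: CHAR_eq_2)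

lemma add_self: "x + x = (0 :: 'a)"
  using two_eq_0 by (metis mult_2 mult_zero_left)

lemma add_eq_0_iff_eq: "x + y = 0 \<longleftrightarrow> x = (y :: 'a)"
  by (metis add_self add_left_cancel)

lemma numeral_even_eq_0: "(numeral (num.Bit0 n) :: 'a) = 0"
  by (simp only: numeral_Bit0 add_self)

lemma numeral_odd_eq_1: "(numeral (num.Bit1 n) :: 'a) = 1"
  by (simp only: numeral_Bit1 add_self) simp

lemma add_self_left: "x + (x + y) = (y :: 'a)"
  by (simp add: add_self flip: add.assoc)

lemma omega_mult_self: "\<omega> * \<omega> = \<omega> + 1" "\<omega> * (\<omega> * x) = \<omega> * x + x"
  using omega_sq by (simp_all add: power2_eq_square algebra_simps flip: mult.assoc)

text \<open>Normal forms over F_2 modulo \<open>\<omega> ^ 2 = \<omega> + 1\<close>: powers of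
  \<open>\<omega>\<close> are reduced, equal terms cancel and numerals are taken modulo 2. This
  settles the polynomial identities below.\<close>

lemmas reduce_simps = algebra_simps power2_eq_square omega_mult_self add_self add_self_left
  numeral_even_eq_0 numeral_odd_eq_1

lemma power_two_power_add: "(x + y :: 'a) ^ 2 ^ k = x ^ 2 ^ k + y ^ 2 ^ k"
  by (rule freshmans_dream') (simp_all add: CHAR_eq_2)

text \<open>The \<open>q\<close>-th power map is the conjugation of the quadratic extension.\<close>

lemma conj_conj: "((x :: 'a) ^ 2 ^ m) ^ 2 ^ m = x"
proof (cases "x = 0")
  case False
  have "((x :: 'a) ^ 2 ^ m) ^ 2 ^ m = x ^ Suc (card (UNIV :: 'a set) - 1)"
    by (simp add: card_UNIV power2_eq_square flip: power_mult)
  with power_card_minus_one[OF False] show ?thesis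
    by simp
qed (simp add: power_0_left)

lemma omega_neq_0: "\<omega> \<noteq> 0"
  using omega_sq by auto

text \<open>Squaring exchanges the two primitive cube roots of unity \<open>\<omega>\<close> and
  \<open>\<omega> + 1\<close>.\<close>

lemma omega_power_two_power: "\<omega> ^ 2 ^ k = (if even k then \<omega> else \<omega> + 1)"
proof (induction k)
  case (Suc k)
  have "\<omega> ^ 2 ^ Suc k = (\<omega> ^ 2 ^ k) ^ 2"
    by (simp add: mult.commute flip: power_mult)
  moreover have "(\<omega> + 1) ^ 2 = \<omega>"
    by (simp add: reduce_simps)
  ultimately show ?case
    using Suc.IH omega_sq by auto
qed simp

section \<open>The linear forms \<open>U\<close> and \<open>V\<close> and the splitting of
  \<open>f_C\<close>\<close>

definition U :: "'a \<Rightarrow> 'a" where "U x = x + \<omega> * x ^ 2 ^ m"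

definition V :: "'a \<Rightarrow> 'a" where "V x = x + (\<omega> + 1) * x ^ 2 ^ m"

lemma U_add: "U (x + y) = U x + U y"
  by (simp add: U_def power_two_power_add algebra_simps)

lemma V_add: "V (x + y) = V x + V y"
  by (simp add: V_def power_two_power_add algebra_simps)

lemma U_power:
  "U x ^ 2 ^ k = x ^ 2 ^ k + (if even k then \<omega> else \<omega> + 1) * (x ^ 2 ^ m) ^ 2 ^ k"
  by (simp add: U_def power_two_power_add power_mult_distrib omega_power_two_power)

lemma V_power:
  "V x ^ 2 ^ k = x ^ 2 ^ k + (if even k then \<omega> + 1 else \<omega>) * (x ^ 2 ^ m) ^ 2 ^ k"
  using two_eq_0
  by (simp add: V_def power_two_power_add power_mult_distrib omega_power_two_power add.assoc)

text \<open>On the right, a monomial with \<open>n\<close> primed factors has coefficient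
  \<open>\<omega> ^ (n + 1) + (\<omega> + 1) ^ (n + 1)\<close>, which is 1, 1, 0, 1 for
  \<open>n\<close> = 0, 1, 2, 3.\<close>

lemma trilinear_split:
  fixes a b c a' b' c' :: 'a
  shows "a' * b' * c' + b' * c * a + c' * b * a + a' * b * c + a * b * c
    = \<omega> * ((a + \<omega> * a') * (b + \<omega> * b') * (c + \<omega> * c'))
      + (\<omega> + 1) * ((a + (\<omega> + 1) * a') * (b + (\<omega> + 1) * b') * (c + (\<omega> + 1) * c'))"
  by (simp add: reduce_simps)

lemma poly_f_C:
  "poly (f_C m i j) x =
     \<omega> * (U x * (if even i then U x else V x) ^ 2 ^ i * (if even j then U x else V x) ^ 2 ^ j)
     + (\<omega> + 1) * (V x * (if even i then V x else U x) ^ 2 ^ i * (if even j then V x else U x) ^ 2 ^ j)"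
proof -
  have "poly (f_C m i j) x =
      x ^ 2 ^ m * (x ^ 2 ^ m) ^ 2 ^ i * (x ^ 2 ^ m) ^ 2 ^ j
      + (x ^ 2 ^ m) ^ 2 ^ i * x ^ 2 ^ j * x + (x ^ 2 ^ m) ^ 2 ^ j * x ^ 2 ^ i * x
      + x ^ 2 ^ m * x ^ 2 ^ i * x ^ 2 ^ j + x * x ^ 2 ^ i * x ^ 2 ^ j"
    by (simp add: f_C_def Let_def poly_monom distrib_left power_add mult_ac flip: power_mult)
  also have "\<dots> = \<omega> * (U x * (x ^ 2 ^ i + \<omega> * (x ^ 2 ^ m) ^ 2 ^ i) * (x ^ 2 ^ j + \<omega> * (x ^ 2 ^ m) ^ 2 ^ j))
      + (\<omega> + 1) * (V x * (x ^ 2 ^ i + (\<omega> + 1) * (x ^ 2 ^ m) ^ 2 ^ i)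
          * (x ^ 2 ^ j + (\<omega> + 1) * (x ^ 2 ^ m) ^ 2 ^ j))"
    unfolding U_def V_def by (rule trilinear_split)
  finally show ?thesis
    by (simp add: U_power V_power)
qed

section \<open>Odd extension degree\<close>

text \<open>If \<open>i\<close> or \<open>j\<close> is odd, both products in \<open>poly_f_C\<close>
  contain a factor \<open>U x\<close>, so \<open>f_C\<close> vanishes on the kernel of
  \<open>U\<close>. For odd \<open>m\<close> this kernel contains \<open>\<omega> + 1\<close>, whose
  conjugate is \<open>\<omega>\<close>.\<close>

lemma not_inj_poly_f_C:
  assumes "odd m" and "odd i \<or> odd j"
  shows "\<not> bij (poly (f_C m i j :: 'a poly))"
proof
  assume bij: "bij (poly (f_C m i j :: 'a poly))"
  have zero: "poly (f_C m i j) x = 0" if "U x = 0" for x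
    using that assms(2) by (auto simp: poly_f_C power_0_left)
  have "U (\<omega> + 1) = 0"
    using assms(1) omega_sq two_eq_0
    by (simp add: U_def power_two_power_add omega_power_two_power add.assoc
        add_self flip: power2_eq_square)
  moreover have "U 0 = 0"
    by (simp add: U_def power_0_left)
  ultimately have "\<omega> + 1 = 0"
    using zero bij_is_inj[OF bij] by (metis injD)
  then show False
    using omega_sq omega_neq_0 by auto
qed

lemma linear_equivalent_odd:
  assumes m: "odd m" and i: "even i" and j: "even j"
  shows "linear_equivalent (poly (f_C m i j :: 'a poly)) ((Fq m :: 'a set) \<times> (Fq m :: 'a set))
    (\<lambda>(u, v). (u ^ (2 ^ i + 2 ^ j + 1), v ^ (2 ^ i + 2 ^ j + 1)))"
proof -
  let ?X = "(Fq m :: 'a set) \<times> (Fq m :: 'a set)"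
  let ?d = "2 ^ i + 2 ^ j + 1 :: nat"
  \<comment> \<open>For odd \<open>m\<close>, conjugation swaps \<open>\<omega>\<close> and
    \<open>\<omega> + 1\<close>. The scalars in \<open>L2\<close> make both coordinates invariant
    under it, and \<open>L1\<close> is the inverse of \<open>L2\<close>.\<close>
  define L1 where "L1 = (\<lambda>(u, v). \<omega> * u + (\<omega> + 1) * v)"
  define L2 where "L2 = (\<lambda>x. (\<omega> * U x, (\<omega> + 1) * V x))"
  have om: "\<omega> ^ 2 ^ m = \<omega> + 1" "(\<omega> + 1) ^ 2 ^ m = \<omega>"
    using m by (simp_all add: power_two_power_add omega_power_two_power add.assoc add_self)
  have L2_in: "L2 x \<in> ?X" for x
  proof -
    have "(\<omega> * U x) ^ 2 ^ m = (\<omega> + 1) * (x ^ 2 ^ m + (\<omega> + 1) * x)"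
      by (simp add: U_def power_mult_distrib power_two_power_add conj_conj om)
    also have "\<dots> = \<omega> * U x"
      unfolding U_def by (simp add: reduce_simps)
    finally have "(\<omega> * U x) ^ 2 ^ m = \<omega> * U x" .
    moreover have "((\<omega> + 1) * V x) ^ 2 ^ m = \<omega> * (x ^ 2 ^ m + \<omega> * x)"
      by (simp only: V_def power_mult_distrib power_two_power_add[of x] conj_conj om)
    moreover have "\<dots> = (\<omega> + 1) * V x"
      unfolding V_def by (simp add: reduce_simps)
    ultimately show ?thesis
      by (simp add: L2_def Fq_def)
  qed
  have L1_L2: "L1 (L2 x) = x" for x
    unfolding L1_def L2_def U_def V_def prod.case by (simp add: reduce_simps)
  have L2_L1: "L2 (L1 p) = p" if p_in: "p \<in> ?X" for p
  proof -
    obtain u v where p: "p = (u, v)" "u ^ 2 ^ m = u" "v ^ 2 ^ m = v"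
      using p_in by (auto simp: Fq_def)
    have c: "(\<omega> * u + (\<omega> + 1) * v) ^ 2 ^ m = (\<omega> + 1) * u + \<omega> * v"
      by (simp only: power_two_power_add[of "_ * _"] power_mult_distrib om p)
    have "\<omega> * U (\<omega> * u + (\<omega> + 1) * v) = u"
      unfolding U_def c by (simp add: reduce_simps)
    moreover have "(\<omega> + 1) * V (\<omega> * u + (\<omega> + 1) * v) = v"
      unfolding V_def c by (simp add: reduce_simps)
    ultimately show ?thesis
      by (simp add: p L1_def L2_def)
  qed
  have bij2: "bij_betw L2 UNIV ?X"
    by (rule bij_betw_byWitness[where f' = L1]) (use L2_in L1_L2 L2_L1 in blast)+
  have bij1: "bij_betw L1 ?X UNIV"
    by (rule bij_betw_byWitness[where f' = L2]) (use L2_in L1_L2 L2_L1 in blast)+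
  have f: "poly (f_C m i j) x = L1 (case L2 x of (u, v) \<Rightarrow> (u ^ ?d, v ^ ?d))" for x
  proof -
    \<comment> \<open>For even \<open>i\<close> and \<open>j\<close> the exponent is divisible by 3,
      so the scalars introduced by \<open>L2\<close> disappear in the power map.\<close>
    have w1: "\<omega> ^ ?d = 1"
      using i j by (simp add: power_add omega_power_two_power reduce_simps)
    have w2: "(\<omega> + 1) ^ ?d = 1"
    proof -
      have "(\<omega> + 1) ^ ?d = (\<omega> + 1) * (\<omega> + 1) * (\<omega> + 1)"
        using i j by (simp only: power_add power_two_power_add omega_power_two_power) simp
      also have "\<dots> = 1"
        by (simp add: reduce_simps)
      finally show ?thesis .
    qed
    show ?thesis
      unfolding L1_def L2_def prod.case power_mult_distrib w1 w2
      using i j by (simp add: poly_f_C power_add mult_ac)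
  qed
  have sub: "(\<lambda>(u, v). (u ^ ?d, v ^ ?d)) ` ?X \<subseteq> ?X"
    by (rule image_subsetI) (simp only: mem_Times_iff case_prod_beta fst_conv snd_conv Fq_power)
  have add2: "L2 (x + y) = L2 x + L2 y" for x y
    by (simp add: L2_def U_add V_add distrib_left)
  have add1: "L1 (p + p') = L1 p + L1 p'" for p p'
    by (cases p; cases p') (simp add: L1_def algebra_simps)
  show ?thesis
    unfolding linear_equivalent_def
    by (intro conjI exI[of _ L1] exI[of _ L2] allI ballI sub bij2 add2 bij1 add1 f)
qed

section \<open>Even extension degree\<close>

text \<open>For \<open>z\<close> in the kernel, conjugating \<open>a * z = b * z ^ q\<close> gives
  \<open>a * z ^ q = b * z\<close>. The determinant of this system is
  \<open>a ^ 2 + b ^ 2 = (a + b) ^ 2\<close>, nonzero for \<open>a \<noteq> b\<close>.\<close>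

lemma bij_conj_combination:
  fixes a b :: 'a
  assumes "a ^ 2 ^ m = a" "b ^ 2 ^ m = b" "a \<noteq> b"
  shows "bij (\<lambda>x. a * x + b * x ^ 2 ^ m)" (is "bij ?L")
proof -
  have "inj ?L"
  proof (rule injI)
    fix x y
    assume "?L x = ?L y"
    moreover define z where "z = x + y"
    moreover have "?L z = ?L x + ?L y"
      by (simp add: z_def power_two_power_add algebra_simps)
    ultimately have z: "a * z = b * z ^ 2 ^ m"
      by (metis add_self add_eq_0_iff_eq)
    then have "(a * z) ^ 2 ^ m = (b * z ^ 2 ^ m) ^ 2 ^ m"
      by simp
    then have z': "a * z ^ 2 ^ m = b * z"
      by (simp add: power_mult_distrib conj_conj assms)
    have "(a + b) * (a + b) * z = a * (a * z) + b * (b * z)"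
      by (simp add: reduce_simps)
    also have "\<dots> = 0"
      unfolding z z'[symmetric] by (simp add: reduce_simps)
    finally have "(a + b) * (a + b) * z = 0" .
    then have "z = 0"
      using assms(3) by (simp add: add_eq_0_iff_eq)
    then show "x = y"
      by (simp add: z_def add_eq_0_iff_eq)
  qed
  then show ?thesis
    by (simp add: bij_def finite_UNIV_inj_surj)
qed

text \<open>The exponent equals \<open>(d - r) + r * q\<close>: of \<open>d\<close> factors
  \<open>x\<close>, exactly \<open>r\<close> are conjugated. Conjugation exchanges the two
  groups.\<close>

lemma power_conj_exponent:
  fixes x :: 'a
  assumes "r \<le> d"
  shows "x ^ (d + r * (2 ^ m - 1)) = x ^ (d - r) * (x ^ 2 ^ m) ^ r"
    and "(x ^ (d + r * (2 ^ m - 1))) ^ 2 ^ m = (x ^ 2 ^ m) ^ (d - r) * x ^ r"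
proof -
  have "r * (2 ^ m - 1) + r = r * 2 ^ m"
    by (simp add: diff_mult_distrib2)
  with assms have "d + r * (2 ^ m - 1) = (d - r) + 2 ^ m * r"
    by (simp add: mult.commute)
  then show eq: "x ^ (d + r * (2 ^ m - 1)) = x ^ (d - r) * (x ^ 2 ^ m) ^ r"
    by (simp only: power_add power_mult)
  have "((x ^ 2 ^ m) ^ r) ^ 2 ^ m = ((x ^ 2 ^ m) ^ 2 ^ m) ^ r"
    by (rule power_power_commute)
  moreover have "(x ^ (d - r)) ^ 2 ^ m = (x ^ 2 ^ m) ^ (d - r)"
    by (rule power_power_commute)
  ultimately show "(x ^ (d + r * (2 ^ m - 1))) ^ 2 ^ m = (x ^ 2 ^ m) ^ (d - r) * x ^ r"
    by (simp only: eq power_mult_distrib conj_conj)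
qed

lemma linear_equivalent_even:
  assumes m: "even m"
  shows "linear_equivalent (poly (f_C m i j :: 'a poly)) (UNIV :: 'a set)
    (\<lambda>x. x ^ (2 ^ i + 2 ^ j + 1 + r_C i j * (2 ^ m - 1)))"
proof -
  let ?d = "2 ^ i + 2 ^ j + 1 :: nat"
  let ?W = "\<lambda>x. U x ^ (?d + r_C i j * (2 ^ m - 1))"
  have om: "\<omega> ^ 2 ^ m = \<omega>"
    using m by (simp add: omega_power_two_power)
  have neq: "\<omega> \<noteq> 1" "\<omega> + 1 \<noteq> 1" "\<omega> \<noteq> \<omega> + 1"
    using omega_sq omega_neq_0 by (auto simp: two_eq_0)
  have r: "r_C i j \<le> ?d"
    by (simp add: r_C_def Let_def)
  have V: "V x = (\<omega> + 1) * U x ^ 2 ^ m" for x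
  proof -
    have c: "U x ^ 2 ^ m = x ^ 2 ^ m + \<omega> * x"
      by (simp add: U_def power_mult_distrib power_two_power_add conj_conj om)
    show ?thesis
      unfolding c V_def by (simp add: reduce_simps)
  qed
  have Vp: "V x ^ 2 ^ k = (if even k then \<omega> + 1 else \<omega>) * (U x ^ 2 ^ m) ^ 2 ^ k" for x k
    by (simp only: V power_mult_distrib power_two_power_add omega_power_two_power)
      (simp add: add.assoc add_self)
  \<comment> \<open>After \<open>V\<close> is replaced by a multiple of the conjugate of
    \<open>U\<close>, the two products in \<open>poly_f_C\<close> are, up to scalars, conjugate to
    each other. One of them is \<open>?W\<close>, and \<open>r_C\<close> counts its conjugated
    factors.\<close>
  have "\<exists>a b. a ^ 2 ^ m = a \<and> b ^ 2 ^ m = b \<and> a \<noteq> b \<and>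
      (\<forall>x. poly (f_C m i j) x = a * ?W x + b * ?W x ^ 2 ^ m)"
  proof -
    have W: "?W x = U x ^ (?d - r_C i j) * (U x ^ 2 ^ m) ^ r_C i j"
      "?W x ^ 2 ^ m = (U x ^ 2 ^ m) ^ (?d - r_C i j) * U x ^ r_C i j" for x
      using power_conj_exponent[OF r] by blast+
    have fixed: "\<omega> ^ 2 ^ m = \<omega>" "(\<omega> + 1) ^ 2 ^ m = \<omega> + 1" "(1::'a) ^ 2 ^ m = 1"
      using om by (simp_all add: power_two_power_add)
    \<comment> \<open>\<open>A\<close>, \<open>B\<close>, \<open>C\<close> stand for
      \<open>U x\<close> and its powers to \<open>2 ^ i\<close> and \<open>2 ^ j\<close>, primes for
      conjugates. Each identity collects the scalars for one parity pattern.\<close>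
    have ids:
      "\<omega> * (A * B * C) + (\<omega> + 1) * (((\<omega> + 1) * A') * ((\<omega> + 1) * B') * ((\<omega> + 1) * C'))
         = \<omega> * (A * B * C) + (\<omega> + 1) * (A' * B' * C')"
      "\<omega> * (A * (\<omega> * B') * (\<omega> * C')) + (\<omega> + 1) * (((\<omega> + 1) * A') * B * C)
         = A * B' * C' + \<omega> * (A' * B * C)"
      "\<omega> * (A * (\<omega> * B') * C) + (\<omega> + 1) * (((\<omega> + 1) * A') * B * ((\<omega> + 1) * C'))
         = (\<omega> + 1) * (A * B' * C) + A' * B * C'"
      "\<omega> * (A * B * (\<omega> * C')) + (\<omega> + 1) * (((\<omega> + 1) * A') * ((\<omega> + 1) * B') * C)
         = (\<omega> + 1) * (A * B * C') + A' * B' * C" for A B C A' B' C'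
      by (simp_all add: reduce_simps)
    note f = poly_f_C[unfolded if_distrib[where f = "\<lambda>t. t ^ _"] Vp]
    consider "even i" "even j" | "odd i" "odd j" | "odd i" "even j" | "even i" "odd j"
      by blast
    then show ?thesis
    proof cases
      case 1
      then have "poly (f_C m i j) x = \<omega> * ?W x + (\<omega> + 1) * ?W x ^ 2 ^ m" for x
        unfolding W(2) unfolding W(1) f V by (simp only: if_True if_False ids) (simp add: r_C_def Let_def power_add mult_ac)
      with fixed neq show ?thesis
        by metis
    next
      case 2
      then have "poly (f_C m i j) x = \<omega> * ?W x + 1 * ?W x ^ 2 ^ m" for x
        unfolding W(2) unfolding W(1) f V by (simp only: if_True if_False ids) (simp add: r_C_def Let_def power_add mult_ac)
      with fixed neq show ?thesis
        by metis
    next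
      case 3
      show ?thesis
      \<comment> \<open>The two conjugate products have \<open>2 ^ i\<close> and
        \<open>2 ^ j + 1\<close> conjugated factors. \<open>r_C\<close> takes the smaller number, so
        the comparison decides which product is \<open>?W\<close> and swaps the
        coefficients.\<close>
      proof (cases "(2::nat) ^ i \<le> 2 ^ j")
        case True
        with 3 have "poly (f_C m i j) x = (\<omega> + 1) * ?W x + 1 * ?W x ^ 2 ^ m" for x
          unfolding W(2) unfolding W(1) f V by (simp only: if_True if_False ids) (simp add: r_C_def Let_def power_add mult_ac)
        with fixed neq show ?thesis
          by metis
      next
        case False
        with 3 have "poly (f_C m i j) x = 1 * ?W x + (\<omega> + 1) * ?W x ^ 2 ^ m" for x
          unfolding W(2) unfolding W(1) f V by (simp only: if_True if_False ids) (simp add: r_C_def Let_def power_add mult_ac)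
        with fixed neq show ?thesis
          by metis
      qed
    next
      case 4
      show ?thesis
      proof (cases "(2::nat) ^ i < 2 ^ j")
        case True
        with 4 have "poly (f_C m i j) x = 1 * ?W x + (\<omega> + 1) * ?W x ^ 2 ^ m" for x
          unfolding W(2) unfolding W(1) f V by (simp only: if_True if_False ids) (simp add: r_C_def Let_def power_add mult_ac)
        with fixed neq show ?thesis
          by metis
      next
        case False
        with 4 have "poly (f_C m i j) x = (\<omega> + 1) * ?W x + 1 * ?W x ^ 2 ^ m" for x
          unfolding W(2) unfolding W(1) f V by (simp only: if_True if_False ids) (simp add: r_C_def Let_def power_add mult_ac)
        with fixed neq show ?thesis
          by metis
      qed
    qed
  qed
  then obtain a b where ab: "a ^ 2 ^ m = a" "b ^ 2 ^ m = b" "a \<noteq> b"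
    and f: "\<And>x. poly (f_C m i j) x = a * ?W x + b * ?W x ^ 2 ^ m"
    by blast
  have "bij U"
    using bij_conj_combination[of 1 \<omega>] om neq by (simp add: U_def[abs_def])
  let ?L1 = "\<lambda>x. a * x + b * x ^ 2 ^ m"
  have add: "?L1 (u + v) = ?L1 u + ?L1 v" for u v
    by (simp add: power_two_power_add algebra_simps)
  show ?thesis
    unfolding linear_equivalent_def
    by (intro conjI exI[of _ ?L1] exI[of _ U] allI ballI subset_UNIV \<open>bij U\<close> U_add
        bij_conj_combination[OF ab] add f)
qed

end

section \<open>Combining the two parities of \<open>m\<close>\<close>

theorem theorem1p4:
  fixes m i j q Q1 Q2 :: nat
  assumes "m > 0" and "i > 0" and "j > 0"
    and "q = 2 ^ m" and "Q1 = 2 ^ i" and "Q2 = 2 ^ j"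
    and "card (UNIV :: 'a::{field,finite} set) = q ^ 2"
  defines "f \<equiv> poly (f_C m i j :: 'a poly)"
    and "case_i \<equiv> odd m \<and> [(1 + i) * (1 + j) = 1] (mod 2) \<and> gcd (Q1 + Q2 + 1) (q - 1) = 1"
    and "case_ii \<equiv> even m \<and> gcd (Q1 + Q2 + 1) (q - 1) = 1 \<and>
           gcd (int Q1 + int Q2 + 1 - 2 * int (r_C i j)) (int q + 1) = 1"
  shows "(bij f \<longleftrightarrow> case_i \<or> case_ii) \<and>
    (case_i \<longrightarrow> linear_equivalent f ((Fq m :: 'a set) \<times> (Fq m :: 'a set))
        (\<lambda>(u::'a, v::'a). (u ^ (Q1 + Q2 + 1), v ^ (Q1 + Q2 + 1)))) \<and>
    (case_ii \<longrightarrow> linear_equivalent f UNIV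
        (\<lambda>x::'a. x ^ (Q1 + Q2 + 1 + r_C i j * (q - 1))))"
proof -
  have q: "q \<ge> 1"
    using assms by simp
  have q2: "q ^ 2 - 1 = (q - 1) * (q + 1)"
    using q by (simp add: algebra_simps power2_eq_square)
  \<comment> \<open>Since 4 is 1 modulo 3, the unit group has order divisible by 3 and contains a
    primitive cube root of unity \<open>w\<close>.\<close>
  have "[(2::nat) ^ 2 = 1] (mod 3)"
    by (simp add: cong_def)
  then have "[(2 ^ 2) ^ m = (1::nat) ^ m] (mod 3)"
    by (rule cong_pow)
  then have "[q ^ 2 = 1] (mod 3)"
    using assms(4) by (metis mult.commute power_mult power_one)
  then have "3 dvd q ^ 2 - 1"
    using q by (metis cong_sym cong_altdef_nat one_le_power)
  then obtain w :: 'a where w: "w \<noteq> 1" "w ^ 3 = 1"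
    using exists_root_of_unity[of 3, where 'a = 'a] assms(7) by auto
  have "(w - 1) * (w ^ 2 + w + 1) = w ^ 3 - 1"
    by (simp add: algebra_simps power2_eq_square power3_eq_cube)
  with w(1) have w2: "w ^ 2 + w + 1 = 0"
    by (simp add: w(2))
  have "CHAR('a) = 2"
    using CHAR_eq_2_if_card_eq_power[where 'a = 'a, of "m * 2"] assms(4,7) by (simp add: power_mult)
  then have "(2 :: 'a) = 0"
    using of_nat_CHAR[where 'a = 'a] by simp
  then have "(w + 1) + (w + 1) = 0"
    by (metis mult_2 mult_zero_left)
  with w2 have w_sq: "w ^ 2 = w + 1"
    by (metis add.assoc add_right_cancel)
  interpret char2_quadratic_extension m w
  proof
    show "card (UNIV :: 'a set) = (2 ^ m) ^ 2"
      using assms(7) unfolding assms(4) .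
    show "w ^ 2 = w + 1"
      by (fact w_sq)
  qed
  let ?d = "Q1 + Q2 + 1"
  have case_i: "case_i \<longleftrightarrow> odd m \<and> even i \<and> even j \<and> coprime ?d (q - 1)"
  proof -
    have "[(1 + i) * (1 + j) = 1] (mod 2) \<longleftrightarrow> odd ((1 + i) * (1 + j))"
      by (simp only: cong_def odd_iff_mod_2_eq_one) simp
    then show ?thesis
      by (auto simp: case_i_def coprime_iff_gcd_eq_1)
  qed
  \<comment> \<open>The two gcd conditions merge into coprimality of the full exponent to
    \<open>q ^ 2 - 1\<close>, the order of the unit group.\<close>
  have case_ii: "case_ii \<longleftrightarrow> even m \<and> coprime (?d + r_C i j * (q - 1)) (q ^ 2 - 1)"
    using coprime_exponent_iff[OF q, of ?d "r_C i j"]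
    by (simp add: case_ii_def coprime_iff_gcd_eq_1 add_ac)
  have lin_i: "linear_equivalent f ((Fq m :: 'a set) \<times> (Fq m :: 'a set)) (\<lambda>(u, v). (u ^ ?d, v ^ ?d))"
    if "odd m" "even i" "even j"
    using linear_equivalent_odd[OF that] assms(5,6) by (simp add: f_def)
  have lin_ii: "linear_equivalent f UNIV (\<lambda>x::'a. x ^ (?d + r_C i j * (q - 1)))" if "even m"
    using linear_equivalent_even[OF that, of i j] assms(4-6) by (simp add: f_def)
  have "bij f \<longleftrightarrow> case_i \<or> case_ii"
  proof (cases "even m")
    case True
    have "{x :: 'a. x ^ Suc (q ^ 2 - 1) = x} = UNIV"
    proof -
      have "x ^ Suc (q ^ 2 - 1) = x" for x :: 'a
        using power_card_minus_one[of x] assms(7) by (cases "x = 0") simp_all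
      then show ?thesis
        by blast
    qed
    then show ?thesis
      using True linear_equivalent_bij_iff[OF lin_ii[OF True]] case_i case_ii assms(7)
        inj_on_power_iff_coprime[of "q ^ 2 - 1" "?d + r_C i j * (q - 1)", where 'a = 'a]
      by simp
  next
    case False
    show ?thesis
    proof (cases "even i \<and> even j")
      case True
      have "{x :: 'a. x ^ Suc (q - 1) = x} = Fq m"
        using assms(1,4) by (simp add: Fq_def)
      then have "inj_on (\<lambda>x. x ^ ?d) (Fq m :: 'a set) \<longleftrightarrow> coprime ?d (q - 1)"
        using inj_on_power_iff_coprime[of "q - 1" ?d, where 'a = 'a] assms(7) q2 by simp
      then show ?thesis
        using True False linear_equivalent_bij_iff[OF lin_i] case_i case_ii
        by (simp add: inj_on_map_prod_same)
    next
      \<comment> \<open>Here \<open>m\<close> is odd and \<open>i\<close> or \<open>j\<close> is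
        odd: both cases fail, and so does injectivity.\<close>
      case not_even: False
      with False show ?thesis
        using not_inj_poly_f_C[of i j] case_i case_ii by (auto simp: f_def)
    qed
  qed
  with lin_i lin_ii case_i case_ii show ?thesis
    by blast
qed

end
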